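(* Let $Z_m$ be an integral operator of the form $$Z_m(f(t);x):=\int_0^\infty f(t)K_m(t,x)\,dt,\quad f\in C_b[0,\infty),\ x>0,$$ with a continuous kernel $K_m:[0,\infty)\times(0,\infty)\to\mathbb{R}$ such that $t\mapsto K_m(t,x)$ is absolutely integrable on $[0,\infty)$ for every $x>0$. Then the condition $$Z_m\left(f\left(\frac{t}{\nu}\right);\nu x\right)=Z_m(f(t);x)\quad\text{for all }\nu\in\mathbb{N},\ x>0,\ f\in C_b[0,\infty)$$ is equivalent to $$K_m(\nu t,\nu x)=\frac{1}{\nu}K_m(t,x)\quad\text{for all real }\nu>0,\ t\ge0,\ x>0.$$
   Context: $C_b[0,\infty)$ is the space of real-valued continuous bounded functions on $[0,\infty)$. The notation $Z_m(f(t/\nu);\nu x)$ means $Z_m$ applied to the function $t\mapsto f(t/\nu)$, evaluated at $\nu x$. *)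

theory Defs
  imports "HOL-Analysis.Analysis"
begin

text \<open>Functions on the half-line are rendered as total functions on the reals; their values at
  negative arguments are unconstrained and never used.\<close>

definition Cb_halfline :: "(real \<Rightarrow> real) set" where
  "Cb_halfline = {f. continuous_on {0..} f \<and> bounded (f ` {0..})}"

definition kernel_operator :: "(real \<Rightarrow> real \<Rightarrow> real) \<Rightarrow> (real \<Rightarrow> real) \<Rightarrow> real \<Rightarrow> real" where
  "kernel_operator K f x = (LINT t:{0..}|lborel. f t * K t x)"

end

theory Submission
  imports Defs
begin

text \<open>The substitution \<open>t = \<nu> s\<close> turns the dilated operator into the operator with kernel
  \<open>\<nu> K(\<nu> s, \<nu> x)\<close>. Homogeneity of the kernel therefore gives invariance of the operator at once.

  Conversely, invariance for a natural number \<open>\<nu>\<close> says that the integrable continuous function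
  \<open>g s = \<nu> K(\<nu> s, \<nu> x) - K(s, x)\<close> integrates to zero against every bounded continuous function.
  Testing it against \<open>g / (1 + \<bar>g\<bar>)\<close>, a bounded continuous function with the same sign as \<open>g\<close>,
  forces \<open>g = 0\<close>: this is \<open>Cb_annihilator_zero\<close>. So the kernel is homogeneous under natural
  dilations; combining a dilation by \<open>m\<close> with the inverse of a dilation by \<open>n\<close> gives the positive
  rationals, and continuity of the kernel along rays extends this to all positive reals.\<close>

lemma kernel_operator_dilate:
  assumes "\<nu> > 0"
  shows "kernel_operator K (\<lambda>t. f (t / \<nu>)) (\<nu> * x)
           = kernel_operator (\<lambda>s y. \<nu> * K (\<nu> * s) (\<nu> * y)) f x"
proof -
  have ind: "indicator {0..} (\<nu> * s) = (indicator {0..} s :: real)" for s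
    using assms by (simp add: indicator_def zero_le_mult_iff)
  have "kernel_operator K (\<lambda>t. f (t / \<nu>)) (\<nu> * x)
          = \<nu> * (LINT s|lborel. indicator {0..} s * (f s * K (\<nu> * s) (\<nu> * x)))"
    unfolding kernel_operator_def set_lebesgue_integral_def
    using assms by (subst lborel_integral_real_affine[where c = \<nu> and t = 0]) (auto simp: ind)
  also have "\<dots> = (LINT s|lborel. \<nu> * (indicator {0..} s * (f s * K (\<nu> * s) (\<nu> * x))))"
    by (rule integral_mult_right_zero[symmetric])
  also have "\<dots> = kernel_operator (\<lambda>s y. \<nu> * K (\<nu> * s) (\<nu> * y)) f x"
    unfolding kernel_operator_def set_lebesgue_integral_def
    by (rule Bochner_Integration.integral_cong) auto
  finally show ?thesis .
qed

lemma set_integrable_dilate: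
  fixes h :: "real \<Rightarrow> real"
  assumes "\<nu> > 0" and "set_integrable lborel {0..} h"
  shows "set_integrable lborel {0..} (\<lambda>s. h (\<nu> * s))"
proof -
  have ind: "indicator {0..} (\<nu> * s) = (indicator {0..} s :: real)" for s
    using assms(1) by (simp add: indicator_def zero_le_mult_iff)
  show ?thesis
    using lborel_integrable_real_affine[OF assms(2)[unfolded set_integrable_def], of \<nu> 0] assms(1)
    unfolding set_integrable_def by (simp add: ind)
qed

lemma continuous_nonneg_integral_zero:
  fixes h :: "real \<Rightarrow> real"
  assumes cont: "continuous_on {0..} h" and nonneg: "\<And>t. t \<ge> 0 \<Longrightarrow> h t \<ge> 0"
    and int: "set_integrable lborel {0..} h" and zero: "(LINT t:{0..}|lborel. h t) = 0"
    and "t \<ge> 0"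
  shows "h t = 0"
proof -
  let ?I = "{0..t + 1}"
  have cont': "continuous_on ?I h"
    by (rule continuous_on_subset[OF cont]) auto
  have on_I: "h integrable_on ?I"
    by (rule integrable_continuous_real[OF cont'])
  have "integral ?I h \<le> integral {0..} h"
    by (rule integral_subset_le)
       (use on_I set_borel_integral_eq_integral(1)[OF int] nonneg in auto)
  also have "\<dots> = 0"
    using set_borel_integral_eq_integral(2)[OF int] zero by simp
  finally have "integral ?I h \<le> 0" .
  moreover have "integral ?I h \<ge> 0"
    by (rule integral_nonneg[OF on_I]) (simp add: nonneg)
  ultimately have "(h has_integral 0) (cbox 0 (t + 1))"
    using integrable_integral[OF on_I] by simp
  then show ?thesis
    using has_integral_0_cbox_imp_0[of 0 "t + 1" h t] cont' nonneg \<open>t \<ge> 0\<close> by simp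
qed

lemma Cb_mult_integrable:
  assumes f: "f \<in> Cb_halfline"
    and h: "continuous_on {0..} h" "set_integrable lborel {0..} h"
  shows "set_integrable lborel {0..} (\<lambda>t. f t * h t)"
proof -
  obtain B where B: "\<And>t. t \<ge> 0 \<Longrightarrow> \<bar>f t\<bar> \<le> B"
    using f by (auto simp: Cb_halfline_def bounded_iff)
  have cont: "continuous_on {0..} (\<lambda>t. f t * h t)"
    using f h(1) by (auto simp: Cb_halfline_def intro: continuous_on_mult)
  show ?thesis
  proof (rule set_integrable_bound[OF set_integrable_mult_right[OF h(2), of B]])
    show "set_borel_measurable lborel {0..} (\<lambda>t. f t * h t)"
      using borel_measurable_continuous_on_indicator[OF _ cont]
      by (simp add: set_borel_measurable_def)
    have "norm (f t * h t) \<le> norm (B * h t)" if "t \<ge> 0" for t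
      using mult_right_mono[OF order_trans[OF B[OF that] abs_ge_self], of "\<bar>h t\<bar>"]
      by (simp add: abs_mult)
    then show "AE t in lborel. t \<in> {0..} \<longrightarrow> norm (f t * h t) \<le> norm (B * h t)"
      by simp
  qed
qed

text \<open>The test function \<open>g / (1 + \<bar>g\<bar>)\<close> is used instead of \<open>g\<close> itself because \<open>g\<close> may be unbounded;
  the product with \<open>g\<close> is still nonnegative, vanishes only where \<open>g\<close> does.\<close>

lemma Cb_annihilator_zero:
  fixes g :: "real \<Rightarrow> real"
  assumes cont: "continuous_on {0..} g" and int: "set_integrable lborel {0..} g"
    and ann: "\<And>f. f \<in> Cb_halfline \<Longrightarrow> (LINT t:{0..}|lborel. f t * g t) = 0"
    and "t \<ge> 0"
  shows "g t = 0"
proof -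
  define f where "f = (\<lambda>t. g t / (1 + \<bar>g t\<bar>))"
  have f_cont: "continuous_on {0..} f"
    unfolding f_def by (intro continuous_intros cont) (auto simp: add_nonneg_eq_0_iff)
  have f_le: "\<bar>f t\<bar> \<le> 1" for t
    by (simp add: f_def divide_le_eq)
  have f_Cb: "f \<in> Cb_halfline"
    using f_cont f_le by (auto simp: Cb_halfline_def bounded_iff)
  have fg_cont: "continuous_on {0..} (\<lambda>t. f t * g t)"
    by (intro continuous_intros f_cont cont)
  note fg_int = Cb_mult_integrable[OF f_Cb cont int]
  have "f t * g t = 0"
    by (rule continuous_nonneg_integral_zero[OF fg_cont _ fg_int ann[OF f_Cb] \<open>t \<ge> 0\<close>])
       (simp add: f_def)
  then show ?thesis
    by (auto simp: f_def add_nonneg_eq_0_iff)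
qed

lemma continuous_kernel_compose:
  fixes K :: "real \<Rightarrow> real \<Rightarrow> real"
  assumes "continuous_on ({0..} \<times> {0<..}) (\<lambda>(t, x). K t x)"
    and "continuous_on S a" "continuous_on S b"
    and "\<And>s. s \<in> S \<Longrightarrow> a s \<ge> 0" "\<And>s. s \<in> S \<Longrightarrow> b s > 0"
  shows "continuous_on S (\<lambda>s. K (a s) (b s))"
  using continuous_on_compose2[OF assms(1) continuous_on_Pair[OF assms(2,3)]] assms(4,5)
  by auto

text \<open>Natural dilations generate the positive rationals: \<open>m K(m s, m y) = K(s, y) = n K(n s, n y)\<close>
  with \<open>s = t / n\<close> and \<open>y = x / n\<close>. Density of the rationals then does the rest, since the set of
  \<open>\<nu> > 0\<close> violating homogeneity is open.\<close>

lemma homogeneous_nat_imp_real: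
  fixes K :: "real \<Rightarrow> real \<Rightarrow> real"
  assumes cont: "continuous_on ({0..} \<times> {0<..}) (\<lambda>(t, x). K t x)"
    and nat: "\<And>n t x. n \<ge> (1::nat) \<Longrightarrow> t \<ge> 0 \<Longrightarrow> x > 0 \<Longrightarrow>
                real n * K (real n * t) (real n * x) = K t x"
    and "\<nu> > 0" "t \<ge> 0" "x > 0"
  shows "\<nu> * K (\<nu> * t) (\<nu> * x) = K t x"
proof (rule ccontr)
  assume violation: "\<nu> * K (\<nu> * t) (\<nu> * x) \<noteq> K t x"
  have rat: "q * K (q * t) (q * x) = K t x" if "q \<in> \<rat>" "q > 0" for q
  proof -
    obtain m n where "n \<noteq> 0" "\<bar>q\<bar> = real m / real n"
      using Rats_abs_nat_div_natE[OF \<open>q \<in> \<rat>\<close>] by metis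
    then have q: "q = real m / real n" and mn: "m \<ge> 1" "n \<ge> 1"
      using \<open>q > 0\<close> by (auto simp: Suc_le_eq intro!: Nat.gr0I)
    have "real m * K (q * t) (q * x) = K (t / real n) (x / real n)"
      using nat[of m "t / real n" "x / real n"] mn \<open>t \<ge> 0\<close> \<open>x > 0\<close> by (simp add: q)
    also have "\<dots> = real n * K t x"
      using nat[of n "t / real n" "x / real n"] mn \<open>t \<ge> 0\<close> \<open>x > 0\<close> by simp
    finally show ?thesis
      using mn by (simp add: q field_simps)
  qed
  let ?h = "\<lambda>r. r * K (r * t) (r * x)"
  let ?V = "{r \<in> {0<..}. ?h r \<in> - {K t x}}"
  have "continuous_on {0<..} ?h"
    by (intro continuous_intros continuous_kernel_compose[OF cont])
       (use \<open>t \<ge> 0\<close> \<open>x > 0\<close> in auto)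
  then have "open ({0<..} \<inter> ?h -` (- {K t x}))"
    by (intro continuous_open_preimage) auto
  moreover have "{0<..} \<inter> ?h -` (- {K t x}) = ?V"
    by auto
  ultimately have "open ?V"
    by simp
  moreover have "\<nu> \<in> ?V \<inter> closure \<rat>"
    using violation \<open>\<nu> > 0\<close> by (simp add: Rats_closure_real)
  ultimately have "?V \<inter> \<rat> \<noteq> {}"
    using open_Int_closure_eq_empty by blast
  then show False
    using rat by auto
qed

theorem theorem12p2:
  fixes K :: "real \<Rightarrow> real \<Rightarrow> real"
  assumes "continuous_on ({0..} \<times> {0<..}) (\<lambda>(t, x). K t x)"
    and "\<And>x. x > 0 \<Longrightarrow> set_integrable lborel {0..} (\<lambda>t. K t x)"
  shows "(\<forall>\<nu>::nat. \<forall>x::real. \<forall>f\<in>Cb_halfline. \<nu> \<ge> 1 \<longrightarrow> x > 0 \<longrightarrow>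
            kernel_operator K (\<lambda>t. f (t / real \<nu>)) (real \<nu> * x) = kernel_operator K f x)
     \<longleftrightarrow> (\<forall>\<nu>::real. \<forall>t::real. \<forall>x::real. \<nu> > 0 \<longrightarrow> t \<ge> 0 \<longrightarrow> x > 0 \<longrightarrow>
            K (\<nu> * t) (\<nu> * x) = 1 / \<nu> * K t x)"
    (is "?invariant \<longleftrightarrow> ?homogeneous")
proof
  assume inv: ?invariant
  have nat: "real n * K (real n * t) (real n * x) = K t x"
    if n: "n \<ge> 1" and "t \<ge> 0" and x: "x > 0" for n :: nat and t x
  proof -
    let ?D = "\<lambda>s. real n * K (real n * s) (real n * x)"
    have n_pos: "real n > 0" and nx_pos: "real n * x > 0"
      using n x by auto
    have D_cont: "continuous_on {0..} ?D"
      by (intro continuous_intros continuous_kernel_compose[OF assms(1)]) (use nx_pos in auto)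
    have K_cont: "continuous_on {0..} (\<lambda>s. K s x)"
      by (intro continuous_intros continuous_kernel_compose[OF assms(1)]) (use x in auto)
    have D_int: "set_integrable lborel {0..} ?D"
      by (intro set_integrable_mult_right set_integrable_dilate[OF n_pos] assms(2)[OF nx_pos])
    note K_int = assms(2)[OF x]
    have "?D t - K t x = 0"
    proof (rule Cb_annihilator_zero[OF continuous_on_diff[OF D_cont K_cont]
          set_integral_diff(1)[OF D_int K_int] _ \<open>t \<ge> 0\<close>])
      fix f assume f: "f \<in> Cb_halfline"
      have "(LINT s:{0..}|lborel. f s * (?D s - K s x))
              = (LINT s:{0..}|lborel. f s * ?D s) - (LINT s:{0..}|lborel. f s * K s x)"
        using set_integral_diff(2)[OF Cb_mult_integrable[OF f D_cont D_int]
            Cb_mult_integrable[OF f K_cont K_int]]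
        by (simp add: right_diff_distrib)
      also have "\<dots> = kernel_operator K (\<lambda>t. f (t / real n)) (real n * x) - kernel_operator K f x"
        unfolding kernel_operator_dilate[OF n_pos] by (simp add: kernel_operator_def)
      also have "\<dots> = 0"
        using inv f n x by simp
      finally show "(LINT s:{0..}|lborel. f s * (?D s - K s x)) = 0" .
    qed
    then show ?thesis
      by simp
  qed
  show ?homogeneous
  proof (intro allI impI)
    fix \<nu> t x :: real
    assume "\<nu> > 0" "t \<ge> 0" "x > 0"
    then show "K (\<nu> * t) (\<nu> * x) = 1 / \<nu> * K t x"
      using homogeneous_nat_imp_real[OF assms(1) nat, of \<nu> t x] by (simp add: field_simps)
  qed
next
  assume hom: ?homogeneous
  show ?invariant
  proof (intro allI ballI impI)
    fix \<nu> :: nat and x :: real and f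
    assume "\<nu> \<ge> 1" "x > 0"
    then have \<nu>_pos: "real \<nu> > 0"
      by simp
    have "kernel_operator (\<lambda>s y. real \<nu> * K (real \<nu> * s) (real \<nu> * y)) f x = kernel_operator K f x"
      unfolding kernel_operator_def
      by (rule set_lebesgue_integral_cong) (use hom \<nu>_pos \<open>x > 0\<close> in auto)
    then show "kernel_operator K (\<lambda>t. f (t / real \<nu>)) (real \<nu> * x) = kernel_operator K f x"
      by (simp add: kernel_operator_dilate[OF \<nu>_pos])
  qed
qed

end
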